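(* Let $\alpha\in(0,1]$ and suppose the random collection $\boldsymbol{\mathcal{R}}\subseteq2^{[m]}$ controls FDR at level $\alpha$. Define the random set $\mathbf{R}=\{i\in[m]:\{i\}\in\boldsymbol{\mathcal{R}}\}$. Then $\mathbf{R}$ controls FWER at level $\alpha$, that is, for every $\mathrm{P}\in M$, $$\mathrm{P}(\mathbf{R}\cap N_\mathrm{P}=\emptyset)\ge 1-\alpha.$$
   Context: Setting: $M$ is a set of probability measures on a common measurable space; random sets and random collections of sets are measurable functions on that space. $m\ge1$, $[m]=\{1,\dots,m\}$, and hypotheses $H_1,\dots,H_m\subseteq M$ are given. For $\mathrm{P}\in M$, $N_\mathrm{P}=\{i\in[m]:\mathrm{P}\in H_i\}$ and $\mathrm{E}_\mathrm{P}$ is expectation under $\mathrm{P}$; $a\vee b=\max(a,b)$. A random collection $\boldsymbol{\mathcal{R}}\subseteq2^{[m]}$ controls FDR at level $\alpha$ if for every $\mathrm{P}\in M$, $\mathrm{E}_\mathrm{P}\big(\max_{R\in\boldsymbol{\mathcal{R}}}\frac{|R\cap N_\mathrm{P}|}{|R|\vee1}\big)\le\alpha$ (the maximum over an empty collection is $0$). *)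

theory Defs
  imports "HOL-Probability.Probability"
begin

text \<open>
  A common measurable space is represented by a measure \<open>\<Omega>\<close>, of which only the
  space and the sigma-algebra are used.  Random sets and random collections of sets take values in
  the finite sets \<open>Pow {1..m}\<close> and \<open>Pow (Pow {1..m})\<close> with all subsets measurable.
\<close>

definition statistical_model :: "'a measure \<Rightarrow> 'a measure set \<Rightarrow> bool" where
  "statistical_model \<Omega> M \<longleftrightarrow> (\<forall>P\<in>M. prob_space P \<and> sets P = sets \<Omega>)"

definition random_set :: "'a measure \<Rightarrow> nat \<Rightarrow> ('a \<Rightarrow> nat set) \<Rightarrow> bool" where
  "random_set \<Omega> m R \<longleftrightarrow> R \<in> \<Omega> \<rightarrow>\<^sub>M count_space (Pow {1..m})"

definition random_collection :: "'a measure \<Rightarrow> nat \<Rightarrow> ('a \<Rightarrow> nat set set) \<Rightarrow> bool" where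
  "random_collection \<Omega> m \<R> \<longleftrightarrow> \<R> \<in> \<Omega> \<rightarrow>\<^sub>M count_space (Pow (Pow {1..m}))"

definition true_nulls :: "nat \<Rightarrow> (nat \<Rightarrow> 'a measure set) \<Rightarrow> 'a measure \<Rightarrow> nat set" where
  "true_nulls m H P = {i\<in>{1..m}. P \<in> H i}"

definition fdp :: "nat set \<Rightarrow> nat set \<Rightarrow> real" where
  "fdp N R = real (card (R \<inter> N)) / real (max (card R) 1)"

definition max_fdp :: "nat set \<Rightarrow> nat set set \<Rightarrow> real" where
  "max_fdp N C = (if C = {} then 0 else Max (fdp N ` C))"

definition controls_FDR ::
    "'a measure set \<Rightarrow> nat \<Rightarrow> (nat \<Rightarrow> 'a measure set) \<Rightarrow> real \<Rightarrow> ('a \<Rightarrow> nat set set) \<Rightarrow> bool" where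
  "controls_FDR M m H \<alpha> \<R> \<longleftrightarrow>
     (\<forall>P\<in>M. (\<integral>\<omega>. max_fdp (true_nulls m H P) (\<R> \<omega>) \<partial>P) \<le> \<alpha>)"

definition controls_FWER ::
    "'a measure set \<Rightarrow> nat \<Rightarrow> (nat \<Rightarrow> 'a measure set) \<Rightarrow> real \<Rightarrow> ('a \<Rightarrow> nat set) \<Rightarrow> bool" where
  "controls_FWER M m H \<alpha> R \<longleftrightarrow>
     (\<forall>P\<in>M. measure P {\<omega>\<in>space P. R \<omega> \<inter> true_nulls m H P = {}} \<ge> 1 - \<alpha>)"

definition singleton_rejections :: "nat \<Rightarrow> ('a \<Rightarrow> nat set set) \<Rightarrow> 'a \<Rightarrow> nat set" where
  "singleton_rejections m \<R> \<omega> = {i\<in>{1..m}. {i} \<in> \<R> \<omega>}"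

lemma random_set_singleton_rejections:
  assumes "random_collection \<Omega> m \<R>"
  shows "random_set \<Omega> m (singleton_rejections m \<R>)"
proof -
  have "(\<lambda>C. {i\<in>{1..m}. {i} \<in> C}) \<in> count_space (Pow (Pow {1..m})) \<rightarrow>\<^sub>M count_space (Pow {1..m})"
    by auto
  from measurable_compose[OF assms[unfolded random_collection_def] this]
  show ?thesis
    unfolding random_set_def singleton_rejections_def .
qed

text \<open>The Bochner integral in \<open>controls_FDR\<close> is a genuine expectation.\<close>

lemma integrable_max_fdp:
  assumes "statistical_model \<Omega> M" "P \<in> M" "random_collection \<Omega> m \<R>"
  shows "integrable P (\<lambda>\<omega>. max_fdp N (\<R> \<omega>))"
proof -
  interpret prob_space P
    using assms(1,2) by (simp add: statistical_model_def)
  have sets: "sets P = sets \<Omega>"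
    using assms(1,2) by (simp add: statistical_model_def)
  have \<R>: "\<R> \<in> P \<rightarrow>\<^sub>M count_space (Pow (Pow {1..m}))"
    using assms(3) unfolding random_collection_def measurable_cong_sets[OF sets refl] .
  have meas: "(\<lambda>\<omega>. max_fdp N (\<R> \<omega>)) \<in> borel_measurable P"
    by (rule measurable_compose[OF \<R>]) simp
  define B where "B = Max ((\<lambda>C. norm (max_fdp N C)) ` Pow (Pow {1..m}))"
  have "norm (max_fdp N (\<R> \<omega>)) \<le> B" if "\<omega> \<in> space P" for \<omega>
    unfolding B_def using measurable_space[OF \<R> that] by (intro Max_ge) auto
  then show ?thesis
    by (intro integrable_const_bound[of _ B] meas AE_I2)
qed

end

theory Submission
  imports Defs
begin

text \<open>A family-wise error means that some \<open>{i}\<close> with \<open>i\<close> a true null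
  lies in the collection. That singleton has false discovery proportion 1
  (\<open>fdp_singleton\<close>), so the maximum over the collection is at least 1
  (\<open>fdp_le_max_fdp\<close>). Hence the indicator of the error event is dominated pointwise by
  the maximal proportion, and taking expectations bounds the error probability by the FDR.\<close>

lemma fdp_le_max_fdp:
  assumes "finite C" "R \<in> C"
  shows "fdp N R \<le> max_fdp N C"
  using assms by (auto simp: max_fdp_def)

text \<open>Gives the domination where no error occurs and the indicator is 0. The empty collection
  is separate: its value 0 is a convention, not a maximum.\<close>

lemma max_fdp_nonneg:
  assumes "finite C"
  shows "0 \<le> max_fdp N C"
proof (cases "C = {}")
  case False
  then obtain R where "R \<in> C" by blast
  have "0 \<le> fdp N R" by (simp add: fdp_def)
  also have "\<dots> \<le> max_fdp N C" by (rule fdp_le_max_fdp) fact+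
  finally show ?thesis .
qed (simp add: max_fdp_def)

lemma fdp_singleton:
  assumes "i \<in> N"
  shows "fdp N {i} = 1"
  using assms by (simp add: fdp_def)

theorem theorem5:
  fixes \<Omega> :: "'a measure"
    and M :: "'a measure set"
    and m :: nat
    and H :: "nat \<Rightarrow> 'a measure set"
    and \<R> :: "'a \<Rightarrow> nat set set"
    and \<alpha> :: real
  assumes "statistical_model \<Omega> M"
    and "m \<ge> 1"
    and "\<forall>i\<in>{1..m}. H i \<subseteq> M"
    and "0 < \<alpha>" and "\<alpha> \<le> 1"
    and "random_collection \<Omega> m \<R>"
    and "controls_FDR M m H \<alpha> \<R>"
  shows "controls_FWER M m H \<alpha> (singleton_rejections m \<R>)"
  unfolding controls_FWER_def
proof
  fix P assume "P \<in> M"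
  then interpret prob_space P
    using assms(1) by (simp add: statistical_model_def)
  have sets: "sets P = sets \<Omega>"
    using assms(1) \<open>P \<in> M\<close> by (simp add: statistical_model_def)
  define N where "N = true_nulls m H P"
  define A where "A = {\<omega>\<in>space P. singleton_rejections m \<R> \<omega> \<inter> N = {}}"
  have \<R>: "\<R> \<in> P \<rightarrow>\<^sub>M count_space (Pow (Pow {1..m}))"
    using assms(6) unfolding random_collection_def measurable_cong_sets[OF sets refl] .
  have S: "singleton_rejections m \<R> \<in> P \<rightarrow>\<^sub>M count_space (Pow {1..m})"
    using random_set_singleton_rejections[OF assms(6)]
    unfolding random_set_def measurable_cong_sets[OF sets refl] .
  \<comment> \<open>As a preimage under a measurable map into a discrete space, \<open>A\<close> is
    an event.\<close>
  have "A = singleton_rejections m \<R> -` {R\<in>Pow {1..m}. R \<inter> N = {}} \<inter> space P"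
    unfolding A_def by (auto simp: singleton_rejections_def)
  then have A: "A \<in> events"
    using measurable_sets[OF S, of "{R\<in>Pow {1..m}. R \<inter> N = {}}"] by auto
  have le: "indicator (space P - A) \<omega> \<le> max_fdp N (\<R> \<omega>)" if \<omega>: "\<omega> \<in> space P" for \<omega>
  proof -
    \<comment> \<open>On \<open>space P\<close> the collection is a subset of the finite set
      \<open>Pow {1..m}\<close>, so \<open>Max\<close> is a true maximum.\<close>
    have fin: "finite (\<R> \<omega>)"
      using measurable_space[OF \<R> \<omega>] by (simp add: finite_subset)
    show ?thesis
    proof (cases "\<omega> \<in> A")
      case True
      then show ?thesis by (simp add: max_fdp_nonneg[OF fin])
    next
      case False
      then obtain i where "{i} \<in> \<R> \<omega>" "i \<in> N"
        using \<omega> by (auto simp: A_def singleton_rejections_def)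
      then have "1 \<le> max_fdp N (\<R> \<omega>)"
        using fdp_le_max_fdp[OF fin, of "{i}" N] by (simp add: fdp_singleton)
      then show ?thesis using \<omega> False by simp
    qed
  qed
  have "1 - prob A = (\<integral>\<omega>. indicator (space P - A) \<omega> \<partial>P)"
    using prob_compl[OF A] by (simp add: Int_absorb2)
  \<comment> \<open>Monotonicity of the Bochner integral asks for integrability on both sides; the
    right side is measurable and bounded because \<R> takes finitely many values.\<close>
  also have "\<dots> \<le> (\<integral>\<omega>. max_fdp N (\<R> \<omega>) \<partial>P)"
    using A le integrable_max_fdp[OF assms(1) \<open>P \<in> M\<close> assms(6)]
    by (intro integral_mono) (auto simp: emeasure_eq_measure)
  also have "\<dots> \<le> \<alpha>"
    using assms(7) \<open>P \<in> M\<close> by (simp add: controls_FDR_def N_def)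
  finally show "1 - \<alpha> \<le> prob {\<omega>\<in>space P. singleton_rejections m \<R> \<omega> \<inter> true_nulls m H P = {}}"
    by (simp add: A_def N_def)
qed

end
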